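(* Let $G$ be a simple graph with $n \geq 3$ vertices and $m$ edges, with degree sequence $\Delta = d_1 \geq d_2 \geq \cdots \geq d_n = \delta > 0$. Then for any $\alpha \in \mathbb{R}$ and any distinct indices $j \neq k$ in $\{1, \dots, n\}$, \[ Z_{2\alpha}(G) \geq \frac{(Z_\alpha(G))^2}{n} + \frac{1}{2}\left(d_j^\alpha - d_k^\alpha\right)^2 + \frac{2n}{n-2}\left(\frac{Z_\alpha(G)}{n} - \frac{d_j^\alpha + d_k^\alpha}{2}\right)^2. \]
   Context: For a graph $G$ with vertex degrees $d_1,\dots,d_n$ and $\beta \in \mathbb{R}$, the first general Zagreb index is $Z_\beta(G) = \sum_{i=1}^n d_i^\beta$. *)

theory Defs
  imports Complex_Main
begin

definition simple_graph :: "'a set \<Rightarrow> 'a set set \<Rightarrow> bool" where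
  "simple_graph V E \<longleftrightarrow> finite V \<and> (\<forall>e\<in>E. e \<subseteq> V \<and> card e = 2)"

definition degree :: "'a set set \<Rightarrow> 'a \<Rightarrow> nat" where
  "degree E v = card {e \<in> E. v \<in> e}"

text \<open>
  The sequence is indexed from 1. Its values outside \<open>{1..n}\<close>, where \<open>n\<close> is the
  number of vertices, are irrelevant.
\<close>

definition is_degree_sequence :: "'a set \<Rightarrow> 'a set set \<Rightarrow> (nat \<Rightarrow> nat) \<Rightarrow> bool" where
  "is_degree_sequence V E d \<longleftrightarrow>
     (\<exists>v. bij_betw v {1..card V} V \<and> (\<forall>i\<in>{1..card V}. d i = degree E (v i))) \<and>
     (\<forall>i\<in>{1..card V}. \<forall>j\<in>{1..card V}. i \<le> j \<longrightarrow> d j \<le> d i)"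

text \<open>
  Since \<open>0 powr \<beta> = 0\<close> for every \<open>\<beta>\<close> (including \<open>\<beta> = 0\<close>), isolated vertices
  contribute nothing; on graphs of positive minimum degree every summand is the
  usual real power.
\<close>

definition zagreb :: "'a set \<Rightarrow> 'a set set \<Rightarrow> real \<Rightarrow> real" where
  "zagreb V E \<beta> = (\<Sum>v\<in>V. real (degree E v) powr \<beta>)"

end

theory Submission
  imports Defs "HOL-Analysis.Convex"
begin

text \<open>
  The inequality is Cauchy--Schwarz for the \<open>n - 2\<close> terms other than the \<open>j\<close>-th and
  \<open>k\<close>-th. If \<open>S\<close> is the sum of all terms, \<open>a\<close>, \<open>b\<close> the two removed ones and \<open>s = a + b\<close>,
  then \<open>a\<^sup>2 + b\<^sup>2 + (S - s)\<^sup>2 / (n - 2)\<close> is identically equal to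
  \<open>S\<^sup>2 / n + (a - b)\<^sup>2 / 2 + 2 n / (n - 2) * (S / n - s / 2)\<^sup>2\<close>.
\<close>

lemma zagreb_split_identity:
  fixes a b S N :: real
  assumes "N > 2"
  shows "S\<^sup>2 / N + 1 / 2 * (a - b)\<^sup>2 + 2 * N / (N - 2) * (S / N - (a + b) / 2)\<^sup>2
    = a\<^sup>2 + b\<^sup>2 + (S - (a + b))\<^sup>2 / (N - 2)"
proof -
  \<comment> \<open>The mean \<open>u\<close> of all terms and the mean \<open>w\<close> of the
    removed pair replace \<open>S\<close> and \<open>a\<close>, so that the last square becomes
    \<open>u - w\<close>.\<close>
  define u where "u = S / N"
  define w where "w = (a + b) / 2"
  have S: "S = N * u" and a: "a = 2 * w - b"
    using assms by (simp_all add: u_def w_def field_simps)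
  have "(N * u)\<^sup>2 / N = N * u\<^sup>2"
    using assms by (simp add: power2_eq_square)
  moreover have "(N * u - 2 * w)\<^sup>2 / (N - 2) - 2 * N / (N - 2) * (u - w)\<^sup>2 = N * u\<^sup>2 - 2 * w\<^sup>2"
  proof -
    \<comment> \<open>The cross terms \<open>4 * N * u * w\<close> cancel, and what remains has the
      factor \<open>N - 2\<close>.\<close>
    have "(N * u - 2 * w)\<^sup>2 - 2 * N * (u - w)\<^sup>2 = (N - 2) * (N * u\<^sup>2 - 2 * w\<^sup>2)"
      by algebra
    then have "((N * u - 2 * w)\<^sup>2 - 2 * N * (u - w)\<^sup>2) / (N - 2) = N * u\<^sup>2 - 2 * w\<^sup>2"
      using assms by simp
    then show ?thesis
      by (simp add: diff_divide_distrib)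
  qed
  \<comment> \<open>Parallelogram law for the removed pair.\<close>
  moreover have "1 / 2 * (a - b)\<^sup>2 + 2 * w\<^sup>2 = a\<^sup>2 + b\<^sup>2"
    by (simp add: w_def power2_eq_square field_simps)
  ultimately show ?thesis
    using assms by (simp add: S a)
qed

lemma sum_squares_ge_two_terms:
  fixes f :: "'a \<Rightarrow> real"
  assumes "finite A" "card A \<ge> 3" "x \<in> A" "y \<in> A" "x \<noteq> y"
  shows "(\<Sum>i\<in>A. f i)\<^sup>2 / real (card A) + 1 / 2 * (f x - f y)\<^sup>2
      + 2 * real (card A) / (real (card A) - 2)
        * ((\<Sum>i\<in>A. f i) / real (card A) - (f x + f y) / 2)\<^sup>2
    \<le> (\<Sum>i\<in>A. (f i)\<^sup>2)"
proof -
  define B where "B = A - {x} - {y}"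
  \<comment> \<open>General in \<open>g\<close> because both \<open>f\<close> and its square are
    split this way.\<close>
  have split: "sum g A = g x + g y + sum g B" for g :: "'a \<Rightarrow> real"
    using assms by (simp add: B_def sum.remove[of A x] sum.remove[of "A - {x}" y])
  have card_B: "real (card B) = real (card A) - 2"
    using assms by (simp add: B_def card_Diff_singleton_if)
  have "(\<Sum>i\<in>B. f i)\<^sup>2 \<le> real (card B) * (\<Sum>i\<in>B. (f i)\<^sup>2)"
    using sum_squared_le_sum_of_squares[of f B] by (simp add: mult.commute)
  then have "(\<Sum>i\<in>B. f i)\<^sup>2 / (real (card A) - 2) \<le> (\<Sum>i\<in>B. (f i)\<^sup>2)"
    using assms card_B by (simp add: divide_le_eq mult.commute)
  then show ?thesis
    using assms by (subst zagreb_split_identity) (simp_all add: split)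
qed

theorem theorem1:
  fixes V :: "'a set" and E :: "'a set set" and n m \<Delta> \<delta> :: nat
    and d :: "nat \<Rightarrow> nat" and \<alpha> :: real and j k :: nat
  assumes "simple_graph V E"
    and "card V = n" and "n \<ge> 3" and "card E = m"
    and "is_degree_sequence V E d"
    and "\<Delta> = d 1" and "d n = \<delta>" and "\<delta> > 0"
    and "j \<in> {1..n}" and "k \<in> {1..n}" and "j \<noteq> k"
  shows "zagreb V E (2 * \<alpha>) \<ge>
      (zagreb V E \<alpha>)\<^sup>2 / real n
      + 1 / 2 * (real (d j) powr \<alpha> - real (d k) powr \<alpha>)\<^sup>2
      + 2 * real n / (real n - 2)
        * (zagreb V E \<alpha> / real n - (real (d j) powr \<alpha> + real (d k) powr \<alpha>) / 2)\<^sup>2"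
proof -
  let ?f = "\<lambda>v. real (degree E v) powr \<alpha>"
  obtain v where v: "bij_betw v {1..n} V" and d: "\<And>i. i \<in> {1..n} \<Longrightarrow> d i = degree E (v i)"
    using assms unfolding is_degree_sequence_def by blast
  \<comment> \<open>The Zagreb sums run over vertices, so the two indices are carried to vertices by
    the enumeration \<open>v\<close>, whose injectivity keeps them distinct.\<close>
  have "v j \<in> V" "v k \<in> V" "v j \<noteq> v k"
    using bij_betwE[OF v] inj_onD[OF bij_betw_imp_inj_on[OF v]] assms(9-11) by blast+
  moreover have "finite V"
    using assms by (simp add: simple_graph_def)
  moreover have "zagreb V E (2 * \<alpha>) = (\<Sum>u\<in>V. (?f u)\<^sup>2)"
    unfolding zagreb_def power2_eq_square by (simp flip: powr_add)
  ultimately show ?thesis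
    using sum_squares_ge_two_terms[of V "v j" "v k" ?f] assms(2,3) d assms(9,10)
    by (simp add: zagreb_def)
qed

end
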